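(* Let $\mathbb K$ be a field of characteristic different from $2$, and let $\mathcal T(\gamma,\rho_0^{[2]})$ denote the non-symmetric generalization of the tridiagonal algebra, with generators $A^{[2]},A^*$ (defined in the context). (1) If $\gamma=\tfrac12$, $\delta_2=0$ and $\delta_1=\rho_0^{[2]}$, then (for any scalars $\delta_3,\delta_4,\delta_5$) the assignment $A^{[2]}\mapsto\kappa_1$, $A^*\mapsto\kappa_2$ defines a unital algebra homomorphism from $\mathcal T(\tfrac12,\rho_0^{[2]})$ to the complementary Bannai–Ito algebra. (2) If $\gamma=0$, $\gamma_2=0$ and $\gamma_1=\rho_0^{[2]}$, then (for any scalars $\gamma_3,\gamma_4,\gamma_5$) the assignment $A^{[2]}\mapsto\kappa_1$, $A^*\mapsto\kappa_2$ defines a unital algebra homomorphism from $\mathcal T(0,\rho_0^{[2]})$ to the dual $-1$ Hahn algebra. In each case the kernel is described by the relations for $\kappa_1,\kappa_2$ in the target algebra: a noncommutative polynomial $f(A^{[2]},A^* )$ is in the kernel if and only if $f(\kappa_1,\kappa_2)=0$ follows from the defining relations of the target.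
   Context: $\mathcal T(\gamma,\rho_0^{[2]})$, for scalars $\gamma,\rho_0^{[2]}\in\mathbb K$: the associative unital $\mathbb K$-algebra generated by two symbols $A^{[2]}$ and $A^*$ (write $B=A^{[2]}$) subject to $$\bigl[B,\;B^2A^*-2BA^*B+A^*B^2-\gamma(BA^*+A^*B)-\rho_0^{[2]}A^*\bigr]=0,$$ $$\bigl[A^*,\;A^{*4}B-2A^{*2}BA^{*2}+BA^{*4}+A^{*3}B-A^{*2}BA^*-A^*BA^{*2}+BA^{*3}-A^{*2}B-2A^*BA^*-BA^{*2}-A^*B-BA^*\bigr]=0.$$ Here $A^{*k}=(A^* )^k$. Complementary Bannai–Ito algebra with scalars $\delta_1,\dots,\delta_5$: associative unital algebra generated by $\kappa_1,\kappa_2,r$ with relations $$[\kappa_1,r]=0,\quad \{\kappa_2,r\}=2\delta_3,\quad r^2=1,$$ $$[\kappa_1,[\kappa_1,\kappa_2]]=\tfrac12\{\kappa_1,\kappa_2\}-\delta_2[\kappa_1,\kappa_2]r-\delta_3\kappa_1r+\delta_1\kappa_2-\delta_1\delta_3r,$$ $$[\kappa_2,[\kappa_2,\kappa_1]]=\tfrac12\kappa_2^2+\delta_2\kappa_2^2r+2\delta_3\kappa_1r+2\delta_3[\kappa_1,\kappa_2]r+\kappa_1+\delta_4r+\delta_5.$$ Dual $-1$ Hahn algebra with scalars $\gamma_1,\dots,\gamma_5$: associative unital algebra generated by $\kappa_1,\kappa_2,r$ with relations $$[\kappa_1,r]=0,\quad \{\kappa_2,r\}=2\gamma_3,\quad r^2=1,$$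 $$[\kappa_1,[\kappa_1,\kappa_2]]=-\gamma_2[\kappa_1,\kappa_2]r+\gamma_1\kappa_2-\gamma_1\gamma_3,$$ $$[\kappa_2,[\kappa_2,\kappa_1]]=\gamma_2\kappa_2^2r+2\gamma_3\kappa_1r+2\gamma_3[\kappa_1,\kappa_2]r+\kappa_1+\gamma_4r+\gamma_5.$$ $[x,y]=xy-yx$ and $\{x,y\}=xy+yx$. *)

theory Defs
  imports "HOL-Algebra.QuotRing" "HOL-Algebra.Module" "HOL-Library.Poly_Mapping"
begin

section \<open>Free associative algebras\<close>

text \<open>
  The free monoid on \<open>'g\<close>, written additively because the convolution product of
  \<^theory>\<open>HOL-Library.Poly_Mapping\<close> expects an additive (here noncommutative) monoid
  of exponents. Thus \<open>'g word \<Rightarrow>\<^sub>0 'k\<close> is the free associative unital algebra over \<open>'k\<close>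
  on \<open>'g\<close>, that is, the ring of noncommutative polynomials.
\<close>

datatype 'g word = Word (letters: "'g list")

instantiation word :: (type) monoid_add
begin

definition zero_word :: "'a word"
  where "0 = Word []"

definition plus_word :: "'a word \<Rightarrow> 'a word \<Rightarrow> 'a word"
  where "u + v = Word (letters u @ letters v)"

instance
  by standard (simp_all add: zero_word_def plus_word_def)

end

type_synonym ('g, 'k) ncpoly = "'g word \<Rightarrow>\<^sub>0 'k"

definition gen :: "'g \<Rightarrow> ('g, 'k::field) ncpoly"
  where "gen g = Poly_Mapping.single (Word [g]) 1"

definition scalar :: "'k \<Rightarrow> ('g, 'k::field) ncpoly"
  where "scalar c = Poly_Mapping.single 0 c"

text \<open>
  An algebra over the field \<open>'k\<close> is a ring record of HOL-Algebra with a scalar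
  multiplication. Only the record type is reused: the locale \<open>algebra\<close> of
  \<^theory>\<open>HOL-Algebra.Module\<close> demands commutativity.
\<close>

definition free_algebra :: "('k::field, ('g, 'k) ncpoly) module"
  where "free_algebra =
    \<lparr>carrier = UNIV, mult = (*), one = 1, zero = 0, add = (+), smult = (\<lambda>c p. scalar c * p)\<rparr>"

definition word_eval :: "('k, 'a) module \<Rightarrow> ('g \<Rightarrow> 'a) \<Rightarrow> 'g word \<Rightarrow> 'a"
  where "word_eval A v w = foldr (\<lambda>g y. v g \<otimes>\<^bsub>A\<^esub> y) (letters w) \<one>\<^bsub>A\<^esub>"

definition nc_eval :: "('k::field, 'a) module \<Rightarrow> ('g \<Rightarrow> 'a) \<Rightarrow> ('g, 'k) ncpoly \<Rightarrow> 'a"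
  where "nc_eval A v f =
    finsum A (\<lambda>w. Poly_Mapping.lookup f w \<odot>\<^bsub>A\<^esub> word_eval A v w) (Poly_Mapping.keys f)"

definition algebra_hom :: "('k, 'a) module \<Rightarrow> ('k, 'b) module \<Rightarrow> ('a \<Rightarrow> 'b) set"
  where "algebra_hom A B =
    {h \<in> ring_hom A B. \<forall>c. \<forall>x \<in> carrier A. h (c \<odot>\<^bsub>A\<^esub> x) = c \<odot>\<^bsub>B\<^esub> h x}"


section \<open>Algebras given by generators and relations\<close>

text \<open>
  A pair \<open>(l, r)\<close> in a set of relations stands for the equation \<open>l = r\<close>. An equation
  \<open>p = 0\<close> follows from the relations iff \<open>p\<close> lies in the two-sided ideal generated by
  the differences \<open>l - r\<close>.
\<close>

definition rel_ideal :: "(('g, 'k::field) ncpoly \<times> ('g, 'k) ncpoly) set \<Rightarrow> ('g, 'k) ncpoly set"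
  where "rel_ideal E = Idl\<^bsub>free_algebra\<^esub> ((\<lambda>(l, r). l - r) ` E)"

definition quotient_algebra :: "('k, 'a) module \<Rightarrow> 'a set \<Rightarrow> ('k, 'a set) module"
  where "quotient_algebra A I =
    \<lparr>carrier = carrier (A Quot I), mult = mult (A Quot I), one = one (A Quot I),
     zero = zero (A Quot I), add = add (A Quot I),
     smult = (\<lambda>c X. \<Union>x\<in>X. I +>\<^bsub>A\<^esub> (c \<odot>\<^bsub>A\<^esub> x))\<rparr>"

definition presented_algebra ::
    "(('g, 'k::field) ncpoly \<times> ('g, 'k) ncpoly) set \<Rightarrow> ('k, ('g, 'k) ncpoly set) module"
  where "presented_algebra E = quotient_algebra free_algebra (rel_ideal E)"

definition presented_gen ::
    "(('g, 'k::field) ncpoly \<times> ('g, 'k) ncpoly) set \<Rightarrow> 'g \<Rightarrow> ('g, 'k) ncpoly set"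
  where "presented_gen E g = rel_ideal E +>\<^bsub>free_algebra\<^esub> gen g"

lemma ring_free_algebra: "ring (free_algebra :: ('k::field, ('g, 'k) ncpoly) module)"
proof (rule ringI)
  have "\<exists>y. y + x = 0" for x :: "('g, 'k) ncpoly"
    by (rule exI[of _ "- x"]) simp
  then show "abelian_group (free_algebra :: ('k, ('g, 'k) ncpoly) module)"
    by (intro abelian_groupI) (auto simp: free_algebra_def add.assoc add.commute)
  show "Group.monoid (free_algebra :: ('k, ('g, 'k) ncpoly) module)"
    by (intro monoidI) (auto simp: free_algebra_def mult.assoc)
qed (auto simp: free_algebra_def distrib_left distrib_right)

lemma ideal_rel_ideal: "ideal (rel_ideal E) free_algebra"
  unfolding rel_ideal_def
  by (rule ring.genideal_ideal[OF ring_free_algebra]) (simp add: free_algebra_def)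

lemma ring_presented_algebra: "ring (presented_algebra E)"
proof -
  interpret Q: ring "free_algebra Quot rel_ideal E"
    by (rule ideal.quotient_is_ring[OF ideal_rel_ideal])
  have inv: "\<exists>y \<in> carrier (presented_algebra E). y \<oplus>\<^bsub>presented_algebra E\<^esub> x = \<zero>\<^bsub>presented_algebra E\<^esub>"
    if "x \<in> carrier (presented_algebra E)" for x
    using that Q.l_neg[of x] Q.a_inv_closed[of x]
    by (auto simp: presented_algebra_def quotient_algebra_def simp del: Q.l_neg)
  have "abelian_group (presented_algebra E)"
    by (rule abelian_groupI, rule_tac [6] inv)
      (simp_all add: presented_algebra_def quotient_algebra_def Q.a_assoc Q.a_comm
        Q.add.m_lcomm)
  moreover have "Group.monoid (presented_algebra E)"
    by (rule monoidI) (simp_all add: presented_algebra_def quotient_algebra_def Q.m_assoc)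
  ultimately show ?thesis
    by (rule ringI) (simp_all add: presented_algebra_def quotient_algebra_def
        Q.l_distr Q.r_distr)
qed

lemma smult_presented_algebra:
  "c \<odot>\<^bsub>presented_algebra E\<^esub> (rel_ideal E +>\<^bsub>free_algebra\<^esub> p)
    = rel_ideal E +>\<^bsub>free_algebra\<^esub> (scalar c * p)"
proof -
  interpret I: ideal "rel_ideal E" free_algebra
    by (rule ideal_rel_ideal)
  have univ: "x \<in> carrier free_algebra" for x :: "('a, 'b) ncpoly"
    by (simp add: free_algebra_def)
  have "rel_ideal E +>\<^bsub>free_algebra\<^esub> (scalar c * x) = rel_ideal E +>\<^bsub>free_algebra\<^esub> (scalar c * p)"
    if x: "x \<in> rel_ideal E +>\<^bsub>free_algebra\<^esub> p" for x
  proof -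
    obtain i where i: "i \<in> rel_ideal E" "x = i + p"
      using x by (auto simp: a_r_coset_def r_coset_def free_algebra_def)
    have "scalar c * i \<in> rel_ideal E"
      using I.I_l_closed[OF i(1) univ, of "scalar c"] by (simp add: free_algebra_def)
    then have "scalar c * x \<in> rel_ideal E +>\<^bsub>free_algebra\<^esub> (scalar c * p)"
      using i(2) by (auto simp: a_r_coset_def r_coset_def free_algebra_def distrib_left)
    then show ?thesis
      by (rule I.a_repr_independence'[OF _ univ, symmetric])
  qed
  then have "(\<Union>x \<in> rel_ideal E +>\<^bsub>free_algebra\<^esub> p. rel_ideal E +>\<^bsub>free_algebra\<^esub> (scalar c * x))
      = rel_ideal E +>\<^bsub>free_algebra\<^esub> (scalar c * p)"
    using I.a_rcos_self[OF univ, of p] by blast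
  moreover have "x \<odot>\<^bsub>free_algebra\<^esub> y = scalar x * y" for x and y :: "('a, 'b) ncpoly"
    by (simp add: free_algebra_def)
  ultimately show ?thesis
    by (simp add: presented_algebra_def quotient_algebra_def)
qed


section \<open>The three algebras\<close>

definition comm :: "'a::ring_1 \<Rightarrow> 'a \<Rightarrow> 'a"
  where "comm x y = x * y - y * x"

definition anticomm :: "'a::ring_1 \<Rightarrow> 'a \<Rightarrow> 'a"
  where "anticomm x y = x * y + y * x"

datatype td_gen = A2 | Astar

definition td_relations :: "'k::field \<Rightarrow> 'k \<Rightarrow> ((td_gen, 'k) ncpoly \<times> (td_gen, 'k) ncpoly) set"
  where "td_relations \<gamma> \<rho> = (let B = gen A2; As = gen Astar in
    {(comm B (B^2 * As - 2 * B * As * B + As * B^2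
         - scalar \<gamma> * (B * As + As * B) - scalar \<rho> * As), 0),
     (comm As (As^4 * B - 2 * As^2 * B * As^2 + B * As^4
         + As^3 * B - As^2 * B * As - As * B * As^2 + B * As^3
         - As^2 * B - 2 * As * B * As - B * As^2
         - As * B - B * As), 0)})"

datatype kr_gen = Kappa1 | Kappa2 | Refl

definition cbi_relations ::
    "'k::field \<Rightarrow> 'k \<Rightarrow> 'k \<Rightarrow> 'k \<Rightarrow> 'k \<Rightarrow> ((kr_gen, 'k) ncpoly \<times> (kr_gen, 'k) ncpoly) set"
  where "cbi_relations \<delta>1 \<delta>2 \<delta>3 \<delta>4 \<delta>5 =
    (let \<kappa>1 = gen Kappa1; \<kappa>2 = gen Kappa2; r = gen Refl in
    {(comm \<kappa>1 r, 0),
     (anticomm \<kappa>2 r, scalar (2 * \<delta>3)),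
     (r^2, 1),
     (comm \<kappa>1 (comm \<kappa>1 \<kappa>2),
        scalar (1/2) * anticomm \<kappa>1 \<kappa>2 - scalar \<delta>2 * comm \<kappa>1 \<kappa>2 * r
        - scalar \<delta>3 * \<kappa>1 * r + scalar \<delta>1 * \<kappa>2 - scalar (\<delta>1 * \<delta>3) * r),
     (comm \<kappa>2 (comm \<kappa>2 \<kappa>1),
        scalar (1/2) * \<kappa>2^2 + scalar \<delta>2 * \<kappa>2^2 * r + scalar (2 * \<delta>3) * \<kappa>1 * r
        + scalar (2 * \<delta>3) * comm \<kappa>1 \<kappa>2 * r + \<kappa>1 + scalar \<delta>4 * r + scalar \<delta>5)})"

definition dual_hahn_relations ::
    "'k::field \<Rightarrow> 'k \<Rightarrow> 'k \<Rightarrow> 'k \<Rightarrow> 'k \<Rightarrow> ((kr_gen, 'k) ncpoly \<times> (kr_gen, 'k) ncpoly) set"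
  where "dual_hahn_relations \<gamma>1 \<gamma>2 \<gamma>3 \<gamma>4 \<gamma>5 =
    (let \<kappa>1 = gen Kappa1; \<kappa>2 = gen Kappa2; r = gen Refl in
    {(comm \<kappa>1 r, 0),
     (anticomm \<kappa>2 r, scalar (2 * \<gamma>3)),
     (r^2, 1),
     (comm \<kappa>1 (comm \<kappa>1 \<kappa>2),
        - scalar \<gamma>2 * comm \<kappa>1 \<kappa>2 * r + scalar \<gamma>1 * \<kappa>2 - scalar (\<gamma>1 * \<gamma>3)),
     (comm \<kappa>2 (comm \<kappa>2 \<kappa>1),
        scalar \<gamma>2 * \<kappa>2^2 * r + scalar (2 * \<gamma>3) * \<kappa>1 * r
        + scalar (2 * \<gamma>3) * comm \<kappa>1 \<kappa>2 * r + \<kappa>1 + scalar \<gamma>4 * r + scalar \<gamma>5)})"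

abbreviation td_algebra :: "'k::field \<Rightarrow> 'k \<Rightarrow> ('k, (td_gen, 'k) ncpoly set) module"
  where "td_algebra \<gamma> \<rho> \<equiv> presented_algebra (td_relations \<gamma> \<rho>)"

end

theory Submission
  imports Defs "HOL-Algebra.UnivPoly"
begin

text \<open>Write \<open>a\<close>, \<open>b\<close> for \<open>\<kappa>\<^sub>1\<close>, \<open>\<kappa>\<^sub>2\<close>. The first tridiagonal relation holds because \<open>[a,[a,b]]\<close> equals
  \<open>\<gamma> {a,b} + \<rho> b\<close> up to terms commuting with \<open>a\<close>. The second one is \<open>[b,{b,{b,y} + y}] = 0\<close>
  for \<open>y = [b,[b,a]] - a\<close>. Here \<open>{b,\<cdot>}\<close> and \<open>[b,\<cdot>]\<close> commute, and \<open>[b,{b,\<cdot>}]\<close> kills every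
  polynomial in \<open>b\<close> as well as \<open>r\<close>, since \<open>{b,r}\<close> is a scalar. The homomorphism sends the class
  of \<open>f\<close> to the class of \<open>f(\<kappa>\<^sub>1,\<kappa>\<^sub>2)\<close>, which gives the kernel.\<close>

section \<open>Evaluation of noncommutative polynomials\<close>

lemma carrier_free_algebra [simp]: "x \<in> carrier free_algebra"
  by (simp add: free_algebra_def)

lemma free_algebra_ops [simp]:
  "x \<otimes>\<^bsub>free_algebra\<^esub> y = x * y" "x \<oplus>\<^bsub>free_algebra\<^esub> y = x + y"
  "\<one>\<^bsub>free_algebra\<^esub> = 1" "\<zero>\<^bsub>free_algebra\<^esub> = 0" "c \<odot>\<^bsub>free_algebra\<^esub> x = scalar c * x"
  by (simp_all add: free_algebra_def)

lemma minus_free_algebra [simp]: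
  fixes x y :: "('g, 'k::field) ncpoly"
  shows "x \<ominus>\<^bsub>free_algebra\<^esub> y = x - y"
proof -
  interpret F: ring "free_algebra :: ('k, ('g, 'k) ncpoly) module"
    by (rule ring_free_algebra)
  have "\<ominus>\<^bsub>free_algebra\<^esub> y = - y"
    by (rule F.minus_equality) simp_all
  then show ?thesis
    by (simp add: a_minus_def)
qed

lemma finsum_free_algebra:
  fixes f :: "'i \<Rightarrow> ('g, 'k::field) ncpoly"
  assumes "finite K"
  shows "finsum (free_algebra :: ('k, ('g, 'k) ncpoly) module) f K = sum f K"
proof -
  interpret F: ring "free_algebra :: ('k, ('g, 'k) ncpoly) module"
    by (rule ring_free_algebra)
  show ?thesis
    using assms by (induction rule: finite_induct) (simp_all add: F.finsum_insert)
qed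

lemma scalar_simps:
  "scalar 0 = 0" "scalar 1 = 1" "scalar (a + b) = scalar a + scalar b"
  "scalar (a * b) = scalar a * scalar b"
  by (simp_all add: scalar_def single_add mult_single)

lemma poly_mapping_sum_single: "f = (\<Sum>w\<in>Poly_Mapping.keys f. Poly_Mapping.single w (Poly_Mapping.lookup f w))"
  by (rule poly_mapping_eqI) (auto simp: lookup_sum lookup_single when_def in_keys_iff)

text \<open>A scalar is supported on the empty word, the neutral element of the word monoid, so it
  commutes with every monomial; the coefficients commute because they lie in a field.\<close>

lemma scalar_commute: "scalar c * p = p * scalar c"
proof -
  have "scalar c * (\<Sum>w\<in>Poly_Mapping.keys p. Poly_Mapping.single w (Poly_Mapping.lookup p w))
      = (\<Sum>w\<in>Poly_Mapping.keys p. Poly_Mapping.single w (Poly_Mapping.lookup p w)) * scalar c"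
    by (simp add: sum_distrib_left sum_distrib_right scalar_def mult_single mult.commute)
  then show ?thesis
    by (simp flip: poly_mapping_sum_single)
qed

section \<open>Evaluation as an algebra homomorphism\<close>

lemma word_eval_add:
  "word_eval free_algebra v (w + u) = word_eval free_algebra v w * word_eval free_algebra v u"
proof -
  have "foldr (\<lambda>g y. v g * y) (xs @ ys) 1
      = foldr (\<lambda>g y. v g * y) xs 1 * foldr (\<lambda>g y. v g * y) ys 1" for xs ys
    by (induction xs) (simp_all add: mult.assoc)
  then show ?thesis
    by (simp add: word_eval_def plus_word_def)
qed

text \<open>The summation range in \<open>nc_eval\<close> varies with the polynomial. A common
  finite range makes the values at \<open>f\<close>, \<open>g\<close> and \<open>f + g\<close>
  comparable term by term.\<close>

lemma nc_eval_free_superset: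
  fixes v :: "'g \<Rightarrow> ('h, 'k::field) ncpoly"
  assumes "finite K" "Poly_Mapping.keys f \<subseteq> K"
  shows "nc_eval free_algebra v f = (\<Sum>w\<in>K. scalar (Poly_Mapping.lookup f w) * word_eval free_algebra v w)"
proof -
  have "nc_eval free_algebra v f
      = (\<Sum>w\<in>Poly_Mapping.keys f. scalar (Poly_Mapping.lookup f w) * word_eval free_algebra v w)"
    by (simp add: nc_eval_def finsum_free_algebra)
  also have "\<dots> = (\<Sum>w\<in>K. scalar (Poly_Mapping.lookup f w) * word_eval free_algebra v w)"
    by (rule sum.mono_neutral_left) (use assms in \<open>auto simp: in_keys_iff scalar_simps\<close>)
  finally show ?thesis .
qed

lemma nc_eval_free_single:
  "nc_eval free_algebra v (Poly_Mapping.single w c) = scalar c * word_eval free_algebra v w"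
  by (subst nc_eval_free_superset[of "{w}"]) simp_all

lemma nc_eval_free_zero: "nc_eval free_algebra v 0 = 0"
  by (subst nc_eval_free_superset[of "{}"]) simp_all

lemma nc_eval_free_add:
  "nc_eval free_algebra v (f + g) = nc_eval free_algebra v f + nc_eval free_algebra v g"
  by (simp add: nc_eval_free_superset[of "Poly_Mapping.keys f \<union> Poly_Mapping.keys g"] Poly_Mapping.keys_add
      lookup_add scalar_simps distrib_right sum.distrib)

lemma nc_eval_free_sum:
  "nc_eval free_algebra v (sum f K) = (\<Sum>i\<in>K. nc_eval free_algebra v (f i))"
  by (induction K rule: infinite_finite_induct) (simp_all add: nc_eval_free_zero nc_eval_free_add)

lemma nc_eval_free_mult:
  "nc_eval free_algebra v (f * g) = nc_eval free_algebra v f * nc_eval free_algebra v g"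
proof -
  let ?S = "\<lambda>f. \<Sum>w\<in>Poly_Mapping.keys f. Poly_Mapping.single w (Poly_Mapping.lookup f w)"
  \<comment> \<open>Multiplicativity is checked on monomials: words are multiplicative under
    evaluation, and the second coefficient moves past the first word because scalars are
    central.\<close>
  have "scalar (a * b) * (x * y) = scalar a * x * (scalar b * y)" for a b and x y :: "('a, 'b) ncpoly"
    by (metis scalar_commute scalar_simps(4) mult.assoc)
  then have "nc_eval free_algebra v (?S f * ?S g) = nc_eval free_algebra v (?S f) * nc_eval free_algebra v (?S g)"
    by (simp add: sum_product mult_single nc_eval_free_sum nc_eval_free_single word_eval_add)
  then show ?thesis
    by (simp flip: poly_mapping_sum_single)
qed

lemma nc_eval_free_scalar: "nc_eval free_algebra v (scalar c) = scalar c"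
  by (simp add: scalar_def nc_eval_free_single word_eval_def zero_word_def)

lemma nc_eval_free_one: "nc_eval free_algebra v 1 = 1"
  using nc_eval_free_scalar[of v 1] by (simp add: scalar_simps)

lemma nc_eval_free_gen: "nc_eval free_algebra v (gen g) = v g"
  by (simp add: gen_def nc_eval_free_single word_eval_def scalar_simps)

lemma nc_eval_free_diff:
  "nc_eval free_algebra v (f - g) = nc_eval free_algebra v f - nc_eval free_algebra v g"
  by (metis nc_eval_free_add add_diff_cancel_right' diff_add_cancel)

lemma nc_eval_free_power: "nc_eval free_algebra v (f ^ n) = nc_eval free_algebra v f ^ n"
  by (induction n) (simp_all add: nc_eval_free_one nc_eval_free_mult)

lemma nc_eval_free_two: "nc_eval free_algebra v 2 = 2"
  by (metis nc_eval_free_add nc_eval_free_one one_add_one)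

lemmas nc_eval_free_simps = nc_eval_free_zero nc_eval_free_one nc_eval_free_two nc_eval_free_add
  nc_eval_free_diff nc_eval_free_mult nc_eval_free_power nc_eval_free_scalar nc_eval_free_gen

lemma word_eval_gen:
  "word_eval (free_algebra :: ('k::field, ('g, 'k) ncpoly) module) gen w = Poly_Mapping.single w 1"
proof -
  have "foldr (\<lambda>g y. gen g * y) xs 1 = (Poly_Mapping.single (Word xs) 1 :: ('g, 'k) ncpoly)" for xs
    by (induction xs) (simp_all add: gen_def mult_single plus_word_def flip: zero_word_def single_one)
  then show ?thesis
    by (simp add: word_eval_def)
qed

text \<open>Each monomial is rebuilt from its letters. After passing to classes, this shows that
  every element of a presented algebra is a polynomial in its generators.\<close>

lemma nc_eval_gen: "nc_eval free_algebra gen f = f"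
proof -
  have "nc_eval free_algebra gen f = (\<Sum>w\<in>Poly_Mapping.keys f. Poly_Mapping.single w (Poly_Mapping.lookup f w))"
    by (simp add: nc_eval_free_superset[OF finite_keys subset_refl] word_eval_gen scalar_def mult_single)
  then show ?thesis
    by (simp flip: poly_mapping_sum_single)
qed

text \<open>Used for the projection onto a presented algebra and for uniqueness of homomorphisms.
  The record type \<open>module\<close> carries no axioms, so closure under scalar multiplication is
  assumed separately.\<close>

lemma algebra_hom_nc_eval:
  assumes "ring A" "ring B" and h: "h \<in> algebra_hom A B" and v: "\<And>g. v g \<in> carrier A"
    and smult: "\<And>c x. x \<in> carrier A \<Longrightarrow> c \<odot>\<^bsub>A\<^esub> x \<in> carrier A"
  shows "h (nc_eval A v f) = nc_eval B (h \<circ> v) f"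
proof -
  interpret A: ring A by fact
  interpret B: ring B by fact
  interpret ring_hom_ring A B h
    using h by unfold_locales (simp add: algebra_hom_def)
  \<comment> \<open>Membership and image go through one induction, since \<open>h\<close> respects a
    product only for factors in the carrier.\<close>
  have fold: "foldr (\<lambda>g y. v g \<otimes>\<^bsub>A\<^esub> y) xs \<one>\<^bsub>A\<^esub> \<in> carrier A \<and>
      h (foldr (\<lambda>g y. v g \<otimes>\<^bsub>A\<^esub> y) xs \<one>\<^bsub>A\<^esub>) = foldr (\<lambda>g y. h (v g) \<otimes>\<^bsub>B\<^esub> y) xs \<one>\<^bsub>B\<^esub>" for xs
    by (induction xs) (simp_all add: v)
  have word: "word_eval A v w \<in> carrier A" "h (word_eval A v w) = word_eval B (h \<circ> v) w" for w
    using fold by (simp_all add: word_eval_def)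
  have scaled: "h (c \<odot>\<^bsub>A\<^esub> word_eval A v w) = c \<odot>\<^bsub>B\<^esub> word_eval B (h \<circ> v) w" for c w
    using h word by (simp add: algebra_hom_def)
  show ?thesis
    unfolding nc_eval_def
    by (subst hom_finsum) (simp_all add: word smult scaled comp_def Pi_def)
qed


section \<open>Homomorphisms between presented algebras\<close>

lemma rel_ideal_coset_eq:
  fixes x y :: "('g, 'k::field) ncpoly"
  shows "rel_ideal E +>\<^bsub>free_algebra\<^esub> x = rel_ideal E +>\<^bsub>free_algebra\<^esub> y \<longleftrightarrow> x - y \<in> rel_ideal E"
  using ring.quotient_eq_iff_same_a_r_cos[OF ring_free_algebra ideal_rel_ideal, of x y E]
  by simp

lemma carrier_presented_algebra:
  "carrier (presented_algebra E) = range (\<lambda>x. rel_ideal E +>\<^bsub>free_algebra\<^esub> x)"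
  by (auto simp: presented_algebra_def quotient_algebra_def FactRing_def A_RCOSETS_def')

lemma zero_presented_algebra: "\<zero>\<^bsub>presented_algebra E\<^esub> = rel_ideal E"
  by (simp add: presented_algebra_def quotient_algebra_def FactRing_def)

lemma one_presented_algebra: "\<one>\<^bsub>presented_algebra E\<^esub> = rel_ideal E +>\<^bsub>free_algebra\<^esub> 1"
  by (simp add: presented_algebra_def quotient_algebra_def FactRing_def)

lemma coset_algebra_hom:
  "(\<lambda>x. rel_ideal E +>\<^bsub>free_algebra\<^esub> x) \<in> algebra_hom free_algebra (presented_algebra E)"
  using ideal.rcos_ring_hom[OF ideal_rel_ideal, of E]
  \<comment> \<open>Scalar multiplication is settled while \<open>presented_algebra\<close> is still
    folded, so that \<open>smult_presented_algebra\<close> applies.\<close>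
  by (simp add: algebra_hom_def ring_hom_def smult_presented_algebra)
    (simp add: presented_algebra_def quotient_algebra_def)

lemma mult_presented_algebra:
  "(rel_ideal E +>\<^bsub>free_algebra\<^esub> x) \<otimes>\<^bsub>presented_algebra E\<^esub> (rel_ideal E +>\<^bsub>free_algebra\<^esub> y)
    = rel_ideal E +>\<^bsub>free_algebra\<^esub> (x * y)"
  using coset_algebra_hom[of E] by (simp add: algebra_hom_def ring_hom_def)

lemma add_presented_algebra:
  "(rel_ideal E +>\<^bsub>free_algebra\<^esub> x) \<oplus>\<^bsub>presented_algebra E\<^esub> (rel_ideal E +>\<^bsub>free_algebra\<^esub> y)
    = rel_ideal E +>\<^bsub>free_algebra\<^esub> (x + y)"
  using coset_algebra_hom[of E] by (simp add: algebra_hom_def ring_hom_def)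

lemma nc_eval_presented_algebra:
  "nc_eval (presented_algebra E) (\<lambda>g. rel_ideal E +>\<^bsub>free_algebra\<^esub> v g) f
    = rel_ideal E +>\<^bsub>free_algebra\<^esub> nc_eval free_algebra v f"
  using algebra_hom_nc_eval[OF ring_free_algebra ring_presented_algebra coset_algebra_hom, of v E f]
  by (simp add: comp_def)

lemma nc_eval_presented_gen:
  "nc_eval (presented_algebra E) (presented_gen E) f = rel_ideal E +>\<^bsub>free_algebra\<^esub> f"
  using nc_eval_presented_algebra[of E gen f] by (simp add: nc_eval_gen presented_gen_def[abs_def])

section \<open>Universal property, uniqueness and kernels\<close>

lemma ideal_closed:
  assumes "ideal I free_algebra"
  shows "0 \<in> I" "x \<in> I \<Longrightarrow> y \<in> I \<Longrightarrow> x + y \<in> I" "x \<in> I \<Longrightarrow> y \<in> I \<Longrightarrow> x - y \<in> I"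
    "x \<in> I \<Longrightarrow> x * z \<in> I" "x \<in> I \<Longrightarrow> z * x \<in> I"
proof -
  interpret ideal I free_algebra by fact
  show "0 \<in> I"
    using additive_subgroup.zero_closed[OF is_additive_subgroup] by simp
  show add: "x \<in> I \<Longrightarrow> y \<in> I \<Longrightarrow> x + y \<in> I" for x y
    using additive_subgroup.a_closed[OF is_additive_subgroup, of x y] by simp
  show "x \<in> I \<Longrightarrow> x * z \<in> I" for x
    using I_r_closed[of x z] by simp
  show left: "x \<in> I \<Longrightarrow> z * x \<in> I" for x z
    using I_l_closed[of x z] by simp
  show "x \<in> I \<Longrightarrow> y \<in> I \<Longrightarrow> x - y \<in> I"
    using add[of x "- 1 * y"] left[of y "- 1"] by simp
qed

text \<open>The preimage of an ideal under the ring homomorphism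
  \<open>nc_eval free_algebra v\<close> is an ideal. It contains the differences that generate
  \<open>rel_ideal E\<close>, hence all of it.\<close>

lemma rel_ideal_subset_preimage:
  fixes v :: "'g \<Rightarrow> ('h, 'k::field) ncpoly"
  assumes "\<And>l r. (l, r) \<in> E \<Longrightarrow> nc_eval free_algebra v (l - r) \<in> rel_ideal E'"
    and "x \<in> rel_ideal E"
  shows "nc_eval free_algebra v x \<in> rel_ideal E'"
proof -
  interpret ring_hom_ring free_algebra free_algebra "nc_eval free_algebra v"
    by (rule ring_hom_ringI2) (simp_all add: ring_free_algebra ring_hom_def nc_eval_free_simps)
  have "rel_ideal E \<subseteq> {x \<in> carrier free_algebra. nc_eval free_algebra v x \<in> rel_ideal E'}"
    unfolding rel_ideal_def[of E]
    using assms(1) by (intro R.genideal_minimal ideal_vimage ideal_rel_ideal) auto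
  then show ?thesis
    using assms(2) by auto
qed

text \<open>The map is computed on a chosen representative of each class. Two representatives differ
  by an element of \<open>rel_ideal E\<close>, which evaluation sends into
  \<open>rel_ideal E'\<close>, so the choice is immaterial.\<close>

lemma presented_algebra_universal:
  fixes v :: "'g \<Rightarrow> ('h, 'k::field) ncpoly"
  assumes rel: "\<And>l r. (l, r) \<in> E \<Longrightarrow> nc_eval free_algebra v (l - r) \<in> rel_ideal E'"
  shows "\<exists>\<phi> \<in> algebra_hom (presented_algebra E) (presented_algebra E').
      (\<forall>f. \<phi> (rel_ideal E +>\<^bsub>free_algebra\<^esub> f)
        = rel_ideal E' +>\<^bsub>free_algebra\<^esub> nc_eval free_algebra v f)"
proof -
  define \<phi> where "\<phi> X = rel_ideal E' +>\<^bsub>free_algebra\<^esub> nc_eval free_algebra v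
    (SOME f. X = rel_ideal E +>\<^bsub>free_algebra\<^esub> f)" for X
  have \<phi>: "\<phi> (rel_ideal E +>\<^bsub>free_algebra\<^esub> f)
      = rel_ideal E' +>\<^bsub>free_algebra\<^esub> nc_eval free_algebra v f" for f
  proof -
    let ?g = "SOME g. rel_ideal E +>\<^bsub>free_algebra\<^esub> f = rel_ideal E +>\<^bsub>free_algebra\<^esub> g"
    have "rel_ideal E +>\<^bsub>free_algebra\<^esub> f = rel_ideal E +>\<^bsub>free_algebra\<^esub> ?g"
      by (rule someI[where x = f]) (rule refl)
    then have "?g - f \<in> rel_ideal E"
      by (metis rel_ideal_coset_eq)
    then have "nc_eval free_algebra v (?g - f) \<in> rel_ideal E'"
      by (rule rel_ideal_subset_preimage[rotated]) (rule rel)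
    then show ?thesis
      by (simp add: \<phi>_def rel_ideal_coset_eq nc_eval_free_simps)
  qed
  have "\<phi> \<in> algebra_hom (presented_algebra E) (presented_algebra E')"
    by (auto simp: algebra_hom_def ring_hom_def carrier_presented_algebra mult_presented_algebra
        add_presented_algebra one_presented_algebra smult_presented_algebra \<phi> nc_eval_free_simps)
  with \<phi> show ?thesis
    by blast
qed

text \<open>Every element is a polynomial in the generators, and homomorphisms commute with
  evaluation.\<close>

lemma presented_algebra_hom_unique:
  assumes "\<phi> \<in> algebra_hom (presented_algebra E) (presented_algebra E')"
    and "\<psi> \<in> algebra_hom (presented_algebra E) (presented_algebra E')"
    and gens: "\<And>g. \<psi> (presented_gen E g) = \<phi> (presented_gen E g)"
    and "x \<in> carrier (presented_algebra E)"
  shows "\<psi> x = \<phi> x"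
proof -
  obtain f where f: "x = nc_eval (presented_algebra E) (presented_gen E) f"
    using assms(4) by (auto simp: carrier_presented_algebra nc_eval_presented_gen)
  have closed: "presented_gen E g \<in> carrier (presented_algebra E)"
    "y \<in> carrier (presented_algebra E) \<Longrightarrow> c \<odot>\<^bsub>presented_algebra E\<^esub> y \<in> carrier (presented_algebra E)"
    for g c y
    by (auto simp: carrier_presented_algebra presented_gen_def smult_presented_algebra)
  have "h x = nc_eval (presented_algebra E') (h \<circ> presented_gen E) f"
    if "h \<in> algebra_hom (presented_algebra E) (presented_algebra E')" for h
    unfolding f
    by (rule algebra_hom_nc_eval[OF ring_presented_algebra ring_presented_algebra that closed])
  moreover have "\<psi> \<circ> presented_gen E = \<phi> \<circ> presented_gen E"
    by (simp add: fun_eq_iff gens)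
  ultimately show ?thesis
    using assms(1,2) by metis
qed

lemma presented_algebra_hom_kernel:
  assumes \<phi>: "\<And>f. \<phi> (rel_ideal E +>\<^bsub>free_algebra\<^esub> f)
      = rel_ideal E' +>\<^bsub>free_algebra\<^esub> nc_eval free_algebra v f"
  shows "nc_eval (presented_algebra E) (presented_gen E) f
      \<in> a_kernel (presented_algebra E) (presented_algebra E') \<phi>
    \<longleftrightarrow> nc_eval free_algebra v f \<in> rel_ideal E'"
proof -
  \<comment> \<open>The zero of the target is the ideal itself; written as the class of 0, it can be
    compared with other classes by \<open>rel_ideal_coset_eq\<close>.\<close>
  have "rel_ideal E' +>\<^bsub>free_algebra\<^esub> 0 = rel_ideal E'"
    by (rule ring.a_rcos_zero[OF ring_free_algebra ideal_rel_ideal])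
      (rule ideal_closed(1)[OF ideal_rel_ideal])
  then show ?thesis
    using rel_ideal_coset_eq[of E' "nc_eval free_algebra v f" 0]
    by (simp add: a_kernel_def' nc_eval_presented_gen carrier_presented_algebra \<phi>
        zero_presented_algebra)
qed


section \<open>The tridiagonal relations\<close>

lemma td_first_relation_eq:
  fixes B A \<gamma> \<rho> :: "'a::ring_1"
  shows "B^2 * A - 2 * B * A * B + A * B^2 - \<gamma> * (B * A + A * B) - \<rho> * A
    = comm B (comm B A) - \<gamma> * anticomm B A - \<rho> * A"
  by (simp add: comm_def anticomm_def algebra_simps power2_eq_square mult_2)

text \<open>With L and R the commuting left and right multiplications by \<open>b\<close>, the
  polynomial is (L + R)(L + R + 1)((L - R)^2 - 1) applied to \<open>a\<close>, where L + R is
  \<open>anticomm b\<close> and L - R is \<open>comm b\<close>.\<close>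

lemma td_second_relation_eq:
  fixes a b :: "'a::ring_1"
  defines "y \<equiv> comm b (comm b a) - a"
  shows "b^4 * a - 2 * b^2 * a * b^2 + a * b^4
      + b^3 * a - b^2 * a * b - b * a * b^2 + a * b^3
      - b^2 * a - 2 * b * a * b - a * b^2 - b * a - a * b
    = anticomm b (anticomm b y + y)"
  by (simp add: y_def comm_def anticomm_def algebra_simps eval_nat_numeral mult_2)

text \<open>With \<open>y = [b,[b,a]] - a\<close> reduced by the last relation, the only term that
  \<open>[b,{b,\<cdot>}]\<close> does not obviously kill is \<open>s (a r + [a,b] r)\<close>. Modulo the relations,
  \<open>{b,\<cdot>} + 1\<close> maps \<open>a r + [a,b] r\<close> to \<open>- (\<eta> b\<^sup>2 r + \<epsilon> + \<delta> r)\<close>.\<close>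
lemma remainder_anticomm_eq:
  fixes a b r s \<eta> \<epsilon> \<delta> :: "'a::ring_1"
  assumes central: "\<And>x. x * s = s * x" "\<And>x. x * \<eta> = \<eta> * x" "\<And>x. x * \<epsilon> = \<epsilon> * x" "\<And>x. x * \<delta> = \<delta> * x"
  defines "X \<equiv> a * r + comm a b * r"
    and "e \<equiv> comm b (comm b a) - (\<eta> * b^2 + s * a * r + s * comm a b * r + a + \<epsilon> * r + \<delta>)"
  shows "anticomm b X + X + \<eta> * b^2 * r + \<epsilon> + \<delta> * r
    = (a + comm a b) * (anticomm b r - s) - e * r - s * (a + comm a b) * (r^2 - 1) - \<epsilon> * (r^2 - 1)"
proof -
  have central': "x * (s * z) = s * (x * z)" "x * (\<eta> * z) = \<eta> * (x * z)"
    "x * (\<epsilon> * z) = \<epsilon> * (x * z)" "x * (\<delta> * z) = \<delta> * (x * z)" for x z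
    by (metis central mult.assoc)+
  show ?thesis
    unfolding X_def e_def comm_def anticomm_def power2_eq_square
    by (simp add: algebra_simps central(1)[of a] central(1)[of b] central'[of a] central'[of b])
qed


text \<open>\<open>Q\<close> kills polynomials in \<open>b\<close> with central coefficients and
  commutes with \<open>anticomm b\<close>, which leaves the contributions of \<open>e\<close>,
  \<open>X\<close> and \<open>r\<close>. Replacing \<open>anticomm b X + X\<close> by
  \<open>R\<close> minus its other terms produces the multiple of \<open>Q r\<close>, because
  \<open>Q\<close> commutes with left multiplication by \<open>b^2\<close>.\<close>

lemma reduced_comm_anticomm_eq:
  fixes b r s \<eta> \<epsilon> \<delta> e X :: "'a::ring_1"
  assumes central: "\<And>x. x * s = s * x" "\<And>x. x * \<eta> = \<eta> * x" "\<And>x. x * \<epsilon> = \<epsilon> * x" "\<And>x. x * \<delta> = \<delta> * x"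
  defines "Q \<equiv> \<lambda>z. comm b (anticomm b z)"
    and "y \<equiv> e + \<eta> * b^2 + s * X + \<epsilon> * r + \<delta>"
    and "R \<equiv> anticomm b X + X + \<eta> * b^2 * r + \<epsilon> + \<delta> * r"
  shows "Q (anticomm b y + y)
    = Q (anticomm b e + e) + s * Q R - s * (\<eta> * b^2 + \<delta>) * Q r + \<epsilon> * (anticomm b (Q r) + Q r)"
proof -
  have central': "x * (s * z) = s * (x * z)" "x * (\<eta> * z) = \<eta> * (x * z)"
    "x * (\<epsilon> * z) = \<epsilon> * (x * z)" "x * (\<delta> * z) = \<delta> * (x * z)" for x z
    by (metis central mult.assoc)+
  show ?thesis
    unfolding Q_def y_def R_def comm_def anticomm_def power2_eq_square
    \<comment> \<open>Centrality is instantiated at \<open>b\<close>: with a free variable, the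
      rules would swap two central factors back and forth forever.\<close>
    by (simp add: algebra_simps central(1)[of b] central(2)[of b] central(3)[of b] central(4)[of b]
        central'[of b])
qed

section \<open>The tridiagonal relations modulo an ideal\<close>

lemma ideal_comm_anticomm:
  assumes "ideal I free_algebra" "x \<in> I"
  shows "comm z x \<in> I" "anticomm z x \<in> I"
  using assms by (simp_all add: comm_def anticomm_def ideal_closed)

text \<open>Here \<open>z\<close> collects what the reduction of [a,[a,b]] contains beyond the
  tridiagonal terms. The outer commutator leaves only an ideal element and [a,z].\<close>

lemma td_first_relation_in_ideal:
  fixes a b z :: "('g, 'k::field) ncpoly"
  assumes I: "ideal I free_algebra"
    and "comm a (comm a b) - (scalar \<gamma> * anticomm a b + scalar \<rho> * b + z) \<in> I" (is "?e \<in> I")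
    and "comm a z \<in> I"
  shows "comm a (a^2 * b - 2 * a * b * a + b * a^2 - scalar \<gamma> * (a * b + b * a) - scalar \<rho> * b) \<in> I"
proof -
  have "comm a (a^2 * b - 2 * a * b * a + b * a^2 - scalar \<gamma> * (a * b + b * a) - scalar \<rho> * b)
      = comm a ?e + comm a z"
    unfolding td_first_relation_eq by (simp add: comm_def algebra_simps)
  then show ?thesis
    using assms by (simp add: ideal_closed ideal_comm_anticomm)
qed

text \<open>The parameters cover both targets: \<eta> is 1/2 or 0, and \<sigma> is the scalar value
  of \<open>anticomm b r\<close>.\<close>

lemma td_second_relation_in_ideal:
  fixes a b r :: "('g, 'k::field) ncpoly"
  assumes I: "ideal I free_algebra"
    and br: "anticomm b r - scalar \<sigma> \<in> I" and r2: "r^2 - 1 \<in> I"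
    and e: "comm b (comm b a) - (scalar \<eta> * b^2 + scalar \<sigma> * a * r + scalar \<sigma> * comm a b * r
        + a + scalar \<epsilon> * r + scalar \<delta>) \<in> I" (is "?e \<in> I")
  shows "comm b (b^4 * a - 2 * b^2 * a * b^2 + a * b^4
      + b^3 * a - b^2 * a * b - b * a * b^2 + a * b^3
      - b^2 * a - 2 * b * a * b - a * b^2 - b * a - a * b) \<in> I"
proof -
  note closed = ideal_closed[OF I] ideal_comm_anticomm[OF I]
  note central = scalar_commute[symmetric]
  define X where "X = a * r + comm a b * r"
  define y where "y = ?e + scalar \<eta> * b^2 + scalar \<sigma> * X + scalar \<epsilon> * r + scalar \<delta>"
  define R where "R = anticomm b X + X + scalar \<eta> * b^2 * r + scalar \<epsilon> + scalar \<delta> * r"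
  \<comment> \<open>An exact identity in the free algebra, not one modulo \<open>I\<close>: the
    defect of the last relation stays in \<open>y\<close> as a summand.\<close>
  have y: "comm b (comm b a) - a = y"
    by (simp add: y_def X_def algebra_simps)
  \<comment> \<open>Each summand on the right contains one of the three given elements of
    \<open>I\<close> as a factor.\<close>
  have "R = (a + comm a b) * (anticomm b r - scalar \<sigma>) - ?e * r
      - scalar \<sigma> * (a + comm a b) * (r^2 - 1) - scalar \<epsilon> * (r^2 - 1)"
    unfolding R_def X_def by (rule remainder_anticomm_eq) (rule central)+
  also have "\<dots> \<in> I"
    by (intro closed(3) closed(4)[OF e] closed(5)[OF br] closed(5)[OF r2])
  finally have R: "R \<in> I" .
  \<comment> \<open>Subtracting a scalar does not change a commutator, and the difference lies in
    \<open>I\<close>.\<close>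
  have "comm b (anticomm b r) = comm b (anticomm b r - scalar \<sigma>)"
    using central[of b \<sigma>] by (simp add: comm_def algebra_simps)
  then have r: "comm b (anticomm b r) \<in> I"
    using br by (simp add: closed)
  have "comm b (anticomm b (anticomm b y + y))
      = comm b (anticomm b (anticomm b ?e + ?e)) + scalar \<sigma> * comm b (anticomm b R)
        - scalar \<sigma> * (scalar \<eta> * b^2 + scalar \<delta>) * comm b (anticomm b r)
        + scalar \<epsilon> * (anticomm b (comm b (anticomm b r)) + comm b (anticomm b r))"
    unfolding y_def R_def by (rule reduced_comm_anticomm_eq) (rule central)+
  also have "\<dots> \<in> I"
    by (intro closed(2) closed(3) closed(5) closed(6) closed(7) e R r)
  finally show ?thesis
    unfolding td_second_relation_eq y .
qed

section \<open>Homomorphisms from the tridiagonal algebra to the two targets\<close>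

lemma rel_idealI: "(l, r) \<in> E \<Longrightarrow> l - r \<in> rel_ideal E"
  unfolding rel_ideal_def
  by (rule subsetD[OF ring.genideal_self[OF ring_free_algebra]]) (auto intro: rev_image_eqI)

text \<open>Reduces existence, uniqueness and the kernel, for any target, to membership of the two
  evaluated relations in its ideal.\<close>

lemma td_hom_exists:
  fixes E :: "(('h, 'k::field) ncpoly \<times> ('h, 'k) ncpoly) set"
  assumes first: "comm (gen a) (gen a^2 * gen b - 2 * gen a * gen b * gen a + gen b * gen a^2
      - scalar \<gamma> * (gen a * gen b + gen b * gen a) - scalar \<rho> * gen b) \<in> rel_ideal E"
    and second: "comm (gen b) (gen b^4 * gen a - 2 * gen b^2 * gen a * gen b^2 + gen a * gen b^4
      + gen b^3 * gen a - gen b^2 * gen a * gen b - gen b * gen a * gen b^2 + gen a * gen b^3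
      - gen b^2 * gen a - 2 * gen b * gen a * gen b - gen a * gen b^2
      - gen b * gen a - gen a * gen b) \<in> rel_ideal E"
  shows "let T = td_algebra \<gamma> \<rho>; t = presented_gen (td_relations \<gamma> \<rho>); C = presented_algebra E
    in \<exists>\<phi> \<in> algebra_hom T C.
         \<phi> (t A2) = presented_gen E a \<and> \<phi> (t Astar) = presented_gen E b \<and>
         (\<forall>\<psi> \<in> algebra_hom T C.
            \<psi> (t A2) = presented_gen E a \<and> \<psi> (t Astar) = presented_gen E b \<longrightarrow>
            (\<forall>x \<in> carrier T. \<psi> x = \<phi> x)) \<and>
         (\<forall>f :: (td_gen, 'k) ncpoly.
            nc_eval T t f \<in> a_kernel T C \<phi> \<longleftrightarrow>
            nc_eval free_algebra (case_td_gen (gen a) (gen b)) f \<in> rel_ideal E)"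
proof -
  let ?v = "case_td_gen (gen a) (gen b) :: td_gen \<Rightarrow> ('h, 'k) ncpoly"
  have rel: "nc_eval free_algebra ?v (l - r) \<in> rel_ideal E" if "(l, r) \<in> td_relations \<gamma> \<rho>" for l r
    using that first second
    by (auto simp: td_relations_def Let_def comm_def nc_eval_free_simps)
  obtain \<phi> where hom: "\<phi> \<in> algebra_hom (td_algebra \<gamma> \<rho>) (presented_algebra E)"
    and \<phi>: "\<phi> (rel_ideal (td_relations \<gamma> \<rho>) +>\<^bsub>free_algebra\<^esub> f)
      = rel_ideal E +>\<^bsub>free_algebra\<^esub> nc_eval free_algebra ?v f" for f
    using presented_algebra_universal[of "td_relations \<gamma> \<rho>" ?v E, OF rel] by blast
  have gens: "\<phi> (presented_gen (td_relations \<gamma> \<rho>) A2) = presented_gen E a"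
    "\<phi> (presented_gen (td_relations \<gamma> \<rho>) Astar) = presented_gen E b"
    by (simp_all add: presented_gen_def \<phi> nc_eval_free_gen)
  have "\<psi> x = \<phi> x"
    if "\<psi> \<in> algebra_hom (td_algebra \<gamma> \<rho>) (presented_algebra E)"
      "\<psi> (presented_gen (td_relations \<gamma> \<rho>) A2) = presented_gen E a"
      "\<psi> (presented_gen (td_relations \<gamma> \<rho>) Astar) = presented_gen E b"
      "x \<in> carrier (td_algebra \<gamma> \<rho>)" for \<psi> x
  proof (rule presented_algebra_hom_unique[OF hom that(1) _ that(4)])
    show "\<psi> (presented_gen (td_relations \<gamma> \<rho>) g) = \<phi> (presented_gen (td_relations \<gamma> \<rho>) g)" for g
      using that(2,3) gens by (cases g) simp_all
  qed
  then show ?thesis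
    unfolding Let_def
    using hom gens presented_algebra_hom_kernel[of \<phi>, OF \<phi>] by blast
qed

text \<open>For \<delta>2 = 0 the rest \<open>?z\<close> of the reduced [a,[a,b]] consists of left
  multiples of \<open>r\<close> by polynomials in \<open>a\<close>, so it commutes with
  \<open>a\<close> modulo [a,r].\<close>

lemma cbi_td_relations:
  fixes \<delta>1 \<delta>3 \<delta>4 \<delta>5 :: "'k::field"
  defines "I \<equiv> rel_ideal (cbi_relations \<delta>1 0 \<delta>3 \<delta>4 \<delta>5)"
    and "a \<equiv> gen Kappa1" and "b \<equiv> gen Kappa2"
  shows "comm a (a^2 * b - 2 * a * b * a + b * a^2 - scalar (1/2) * (a * b + b * a) - scalar \<delta>1 * b) \<in> I"
    and "comm b (b^4 * a - 2 * b^2 * a * b^2 + a * b^4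
      + b^3 * a - b^2 * a * b - b * a * b^2 + a * b^3
      - b^2 * a - 2 * b * a * b - a * b^2 - b * a - a * b) \<in> I"
proof -
  let ?r = "gen Refl :: (kr_gen, 'k) ncpoly"
  let ?z = "- (scalar \<delta>3 * a * ?r) - scalar (\<delta>1 * \<delta>3) * ?r"
  have I: "ideal I free_algebra"
    unfolding I_def by (rule ideal_rel_ideal)
  have rel: "l - r \<in> I" if "(l, r) \<in> cbi_relations \<delta>1 0 \<delta>3 \<delta>4 \<delta>5" for l r
    unfolding I_def using that by (rule rel_idealI)
  have ar: "comm a ?r \<in> I"
    using rel[of "comm a ?r" 0] by (simp add: cbi_relations_def Let_def a_def b_def)
  have br: "anticomm b ?r - scalar (2 * \<delta>3) \<in> I" and r2: "?r^2 - 1 \<in> I"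
    by (rule rel; simp add: cbi_relations_def Let_def a_def b_def)+
  \<comment> \<open>The vanishing coefficient is first written as \<open>scalar 0\<close> to match
    the relation literally, then simplified away.\<close>
  have "comm a (comm a b) - (scalar (1/2) * anticomm a b - scalar 0 * comm a b * ?r
      - scalar \<delta>3 * a * ?r + scalar \<delta>1 * b - scalar (\<delta>1 * \<delta>3) * ?r) \<in> I"
    by (rule rel) (simp add: cbi_relations_def Let_def a_def b_def)
  then have e1: "comm a (comm a b) - (scalar (1/2) * anticomm a b + scalar \<delta>1 * b + ?z) \<in> I"
    by (simp add: scalar_simps algebra_simps)
  have "comm b (comm b a) - (scalar (1/2) * b^2 + scalar 0 * b^2 * ?r + scalar (2 * \<delta>3) * a * ?r
        + scalar (2 * \<delta>3) * comm a b * ?r + a + scalar \<delta>4 * ?r + scalar \<delta>5) \<in> I"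
    by (rule rel) (simp add: cbi_relations_def Let_def a_def b_def)
  then have e2: "comm b (comm b a) - (scalar (1/2) * b^2 + scalar (2 * \<delta>3) * a * ?r
        + scalar (2 * \<delta>3) * comm a b * ?r + a + scalar \<delta>4 * ?r + scalar \<delta>5) \<in> I"
    by (simp add: scalar_simps)
  have "comm a ?z = (- (scalar \<delta>3 * a) - scalar (\<delta>1 * \<delta>3)) * comm a ?r"
  proof -
    have "a * (scalar c * x) = scalar c * (a * x)" for c x
      by (metis scalar_commute mult.assoc)
    then show ?thesis
      by (simp add: comm_def algebra_simps)
  qed
  then have "comm a ?z \<in> I"
    using ar ideal_closed(5)[OF I] by simp
  with e1 show "comm a (a^2 * b - 2 * a * b * a + b * a^2 - scalar (1/2) * (a * b + b * a) - scalar \<delta>1 * b) \<in> I"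
    by (rule td_first_relation_in_ideal[OF I])
  show "comm b (b^4 * a - 2 * b^2 * a * b^2 + a * b^4
      + b^3 * a - b^2 * a * b - b * a * b^2 + a * b^3
      - b^2 * a - 2 * b * a * b - a * b^2 - b * a - a * b) \<in> I"
    by (rule td_second_relation_in_ideal[OF I br r2 e2])
qed

text \<open>For \<gamma>2 = 0 the rest \<open>?z\<close> is a scalar, so [a,z] vanishes
  outright.\<close>

lemma dual_hahn_td_relations:
  fixes \<gamma>1 \<gamma>3 \<gamma>4 \<gamma>5 :: "'k::field"
  defines "I \<equiv> rel_ideal (dual_hahn_relations \<gamma>1 0 \<gamma>3 \<gamma>4 \<gamma>5)"
    and "a \<equiv> gen Kappa1" and "b \<equiv> gen Kappa2"
  shows "comm a (a^2 * b - 2 * a * b * a + b * a^2 - scalar 0 * (a * b + b * a) - scalar \<gamma>1 * b) \<in> I"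
    and "comm b (b^4 * a - 2 * b^2 * a * b^2 + a * b^4
      + b^3 * a - b^2 * a * b - b * a * b^2 + a * b^3
      - b^2 * a - 2 * b * a * b - a * b^2 - b * a - a * b) \<in> I"
proof -
  let ?r = "gen Refl :: (kr_gen, 'k) ncpoly"
  let ?z = "- scalar (\<gamma>1 * \<gamma>3) :: (kr_gen, 'k) ncpoly"
  have I: "ideal I free_algebra"
    unfolding I_def by (rule ideal_rel_ideal)
  have rel: "l - r \<in> I" if "(l, r) \<in> dual_hahn_relations \<gamma>1 0 \<gamma>3 \<gamma>4 \<gamma>5" for l r
    unfolding I_def using that by (rule rel_idealI)
  have br: "anticomm b ?r - scalar (2 * \<gamma>3) \<in> I" and r2: "?r^2 - 1 \<in> I"
    by (rule rel; simp add: dual_hahn_relations_def Let_def a_def b_def)+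
  have "comm a (comm a b)
      - (- scalar 0 * comm a b * ?r + scalar \<gamma>1 * b - scalar (\<gamma>1 * \<gamma>3)) \<in> I"
    by (rule rel) (simp add: dual_hahn_relations_def Let_def a_def b_def)
  then have e1: "comm a (comm a b) - (scalar 0 * anticomm a b + scalar \<gamma>1 * b + ?z) \<in> I"
    by (simp add: scalar_simps)
  have "comm b (comm b a) - (scalar 0 * b^2 * ?r + scalar (2 * \<gamma>3) * a * ?r
        + scalar (2 * \<gamma>3) * comm a b * ?r + a + scalar \<gamma>4 * ?r + scalar \<gamma>5) \<in> I"
    by (rule rel) (simp add: dual_hahn_relations_def Let_def a_def b_def)
  \<comment> \<open>The zero multiple of \<open>b^2\<close> gives the relation the shape of the
    second tridiagonal lemma with \<eta> = 0.\<close>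
  then have e2: "comm b (comm b a) - (scalar 0 * b^2 + scalar (2 * \<gamma>3) * a * ?r
        + scalar (2 * \<gamma>3) * comm a b * ?r + a + scalar \<gamma>4 * ?r + scalar \<gamma>5) \<in> I"
    by (simp add: scalar_simps)
  have "comm a ?z \<in> I"
    using scalar_commute[of "\<gamma>1 * \<gamma>3" a] by (simp add: comm_def ideal_closed(1)[OF I])
  with e1 show "comm a (a^2 * b - 2 * a * b * a + b * a^2 - scalar 0 * (a * b + b * a) - scalar \<gamma>1 * b) \<in> I"
    by (rule td_first_relation_in_ideal[OF I])
  show "comm b (b^4 * a - 2 * b^2 * a * b^2 + a * b^4
      + b^3 * a - b^2 * a * b - b * a * b^2 + a * b^3
      - b^2 * a - 2 * b * a * b - a * b^2 - b * a - a * b) \<in> I"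
    by (rule td_second_relation_in_ideal[OF I br r2 e2])
qed

theorem proposition5p5:
  fixes \<gamma> \<rho> :: "'k::field"
    and \<delta>1 \<delta>2 \<delta>3 \<delta>4 \<delta>5 \<gamma>1 \<gamma>2 \<gamma>3 \<gamma>4 \<gamma>5 :: 'k
  assumes "CHAR('k) \<noteq> 2"
  shows
    "(\<gamma> = 1/2 \<and> \<delta>2 = 0 \<and> \<delta>1 = \<rho> \<longrightarrow>
       (let T = td_algebra \<gamma> \<rho>; t = presented_gen (td_relations \<gamma> \<rho>);
            E = cbi_relations \<delta>1 \<delta>2 \<delta>3 \<delta>4 \<delta>5; C = presented_algebra E
        in \<exists>\<phi> \<in> algebra_hom T C.
             \<phi> (t A2) = presented_gen E Kappa1 \<and> \<phi> (t Astar) = presented_gen E Kappa2 \<and>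
             (\<forall>\<psi> \<in> algebra_hom T C.
                \<psi> (t A2) = presented_gen E Kappa1 \<and> \<psi> (t Astar) = presented_gen E Kappa2 \<longrightarrow>
                (\<forall>x \<in> carrier T. \<psi> x = \<phi> x)) \<and>
             (\<forall>f :: (td_gen, 'k) ncpoly.
                nc_eval T t f \<in> a_kernel T C \<phi> \<longleftrightarrow>
                nc_eval free_algebra (case_td_gen (gen Kappa1) (gen Kappa2)) f \<in> rel_ideal E)))
     \<and>
     (\<gamma> = 0 \<and> \<gamma>2 = 0 \<and> \<gamma>1 = \<rho> \<longrightarrow>
       (let T = td_algebra \<gamma> \<rho>; t = presented_gen (td_relations \<gamma> \<rho>);
            E = dual_hahn_relations \<gamma>1 \<gamma>2 \<gamma>3 \<gamma>4 \<gamma>5; C = presented_algebra E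
        in \<exists>\<phi> \<in> algebra_hom T C.
             \<phi> (t A2) = presented_gen E Kappa1 \<and> \<phi> (t Astar) = presented_gen E Kappa2 \<and>
             (\<forall>\<psi> \<in> algebra_hom T C.
                \<psi> (t A2) = presented_gen E Kappa1 \<and> \<psi> (t Astar) = presented_gen E Kappa2 \<longrightarrow>
                (\<forall>x \<in> carrier T. \<psi> x = \<phi> x)) \<and>
             (\<forall>f :: (td_gen, 'k) ncpoly.
                nc_eval T t f \<in> a_kernel T C \<phi> \<longleftrightarrow>
                nc_eval free_algebra (case_td_gen (gen Kappa1) (gen Kappa2)) f \<in> rel_ideal E)))"
  \<comment> \<open>The conditions on the parameters are equations; substituting them turns both
    implications into instances of \<open>td_hom_exists\<close>.\<close>
  using td_hom_exists[OF cbi_td_relations[of \<delta>1 \<delta>3 \<delta>4 \<delta>5]]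
    td_hom_exists[OF dual_hahn_td_relations[of \<gamma>1 \<gamma>3 \<gamma>4 \<gamma>5]]
  unfolding Let_def by blast

end
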